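(* Let $\kappa_1=2\log_2\left(\frac{\sqrt5+1}{2}\right)-1\approx 0.38848383$. Let $x$ be either the smallest or the greatest fixed point of the Minkowski question mark function $?$ in the open interval $(0,\frac12)$, and let $x=[a_1,a_2,\ldots,a_n,\ldots]$ be its continued fraction expansion. Then $$a_{n+1}<\kappa_1\sum_{i=1}^{n}a_i+2\log_2\left(\sum_{i=1}^{n}a_i\right)\qquad\text{for all } n\ge 1.$$
   Context: For positive integers $a_j$, $[a_1,a_2,\ldots]=\cfrac{1}{a_1+\cfrac{1}{a_2+\cdots}}$ denotes the (finite or infinite) continued fraction with zero integer part. The Minkowski question mark function $?:[0,1]\to[0,1]$ is defined by $?(0)=0$ and, for $x=[a_1,a_2,\ldots]\in(0,1]$, by $$?(x)=\sum_{k\ge 1}\frac{(-1)^{k+1}}{2^{a_1+\cdots+a_k-1}},$$ the sum being infinite if $x$ is irrational and finite (over all partial quotients) if $x$ is rational; the value does not depend on which of the two finite expansions of a rational number is used. The function $?$ is continuous and strictly increasing, with $?(0)=0$, $?(\frac12)=\frac12$, $?(1)=1$. A fixed point is a solution of $?(x)=x$. All fixed points in $(0,\frac12)$ are irrational, and the smallest and the greatest fixed points in $(0,\frac12)$ exist (they might coincide). *)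

theory Defs
  imports Complex_Main
begin

text \<open>
  Partial quotients are given by a function \<open>a :: nat \<Rightarrow> nat\<close> indexed from 1;
  the value \<open>a 0\<close> plays no role.
\<close>

fun cfrac :: "nat list \<Rightarrow> real" where
  "cfrac [] = 0"
| "cfrac (a # as) = 1 / (real a + cfrac as)"

definition fin_cfrac :: "(nat \<Rightarrow> nat) \<Rightarrow> nat \<Rightarrow> real" where
  "fin_cfrac a m = cfrac (map a [1..<m + 1])"

definition has_fin_cfrac :: "real \<Rightarrow> (nat \<Rightarrow> nat) \<Rightarrow> nat \<Rightarrow> bool" where
  "has_fin_cfrac x a m \<longleftrightarrow> m \<ge> 1 \<and> (\<forall>i\<in>{1..m}. a i > 0) \<and> x = fin_cfrac a m"

definition has_inf_cfrac :: "real \<Rightarrow> (nat \<Rightarrow> nat) \<Rightarrow> bool" where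
  "has_inf_cfrac x a \<longleftrightarrow> (\<forall>i\<ge>1. a i > 0) \<and> (\<lambda>m. fin_cfrac a m) \<longlonglongrightarrow> x"

definition qm_term :: "(nat \<Rightarrow> nat) \<Rightarrow> nat \<Rightarrow> real" where
  "qm_term a k = (-1) ^ (k + 1) / 2 ^ ((\<Sum>i=1..k. a i) - 1)"

text \<open>
  The Minkowski question mark function. The sum has the same value for both finite
  expansions of a rational number, so the description is unique for \<open>0 < x \<le> 1\<close>;
  the function is unspecified outside \<open>[0, 1]\<close>. The shift \<open>k + 1\<close> turns the
  series over \<open>k \<ge> 1\<close> into one over all natural numbers.
\<close>

definition question_mark :: "real \<Rightarrow> real" where
  "question_mark x =
     (if x = 0 then 0
      else (THE y. (\<exists>a m. has_fin_cfrac x a m \<and> y = (\<Sum>k=1..m. qm_term a k)) \<or>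
                   (\<exists>a. has_inf_cfrac x a \<and> (\<lambda>k. qm_term a (k + 1)) sums y)))"

definition qm_fixed_points :: "real set" where
  "qm_fixed_points = {x. 0 < x \<and> x < 1 / 2 \<and> question_mark x = x}"

definition kappa1 :: real where
  "kappa1 = 2 * log 2 ((sqrt 5 + 1) / 2) - 1"

end

theory Submission
  imports Defs "HOL-Analysis.Uniform_Limit"
begin

text \<open>
  Let \<open>S = a 1 + \<dots> + a n\<close>, \<open>A = a (n + 1)\<close>, and let \<open>q\<^sub>n\<close> be the denominator of the \<open>n\<close>-th
  convergent. If \<open>x\<close> is the smallest fixed point in \<open>(0, 1 / 2)\<close>, then \<open>?(y) < y\<close> for \<open>0 < y < x\<close>;
  if it is the greatest one, then \<open>?(y) > y\<close> for \<open>x < y < 1 / 2\<close>. This is because \<open>?\<close> is continuous,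
  below the diagonal near \<open>0\<close> and above it near \<open>1 / 2\<close>. So on one side of \<open>x\<close>,
  within \<open>(0, 1 / 2)\<close>, all difference quotients of \<open>?\<close> at \<open>x\<close> exceed \<open>1\<close>. On the other hand, on the cylinder of
  \<open>a 1, \<dots>, a n\<close> the function \<open>?\<close> is an affine image, with factor \<open>2 ^ (- S)\<close>, of \<open>?\<close> in the
  remainder, and the remainder of \<open>x\<close> is \<open>1 / (A + \<theta>)\<close> for some \<open>\<theta>\<close> in
  \<open>(0, 1)\<close>, with \<open>?(1 / (A + \<theta>)) \<le> 2 ^ (1 - A)\<close>. So a
  large \<open>A\<close> makes \<open>?\<close> flat near \<open>x\<close>. Comparing \<open>x\<close> with the convergent, or with
  \<open>[a 1, \<dots>, a n, A - 1]\<close> if the convergent lies on the wrong side, gives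
  \<open>2 ^ (A + S) < 2 q\<^sub>n\<^sup>2 A (A + 2)\<close> for \<open>A \<ge> 2\<close> (lemma \<open>partial_quotient_bound\<close>).

  As \<open>q\<^sub>n\<close> is at most a constant times \<open>\<phi> ^ S\<close> for the golden ratio \<open>\<phi>\<close>, and
  \<open>2 ^ \<kappa>\<^sub>1 = \<phi>\<^sup>2 / 2\<close>, the claim follows once \<open>S\<close> is large enough
  (lemma \<open>kappa1_bound_from_power_bound\<close>). Small \<open>S\<close> are settled by locating the fixed points:
  an infinite expansion of a fixed point in \<open>(0, 1 / 2)\<close> starts with \<open>2, 2, 1, 1, 1, 3\<close>
  (lemma \<open>fixed_point_digits\<close>), which covers \<open>n \<le> 5\<close>, and gives \<open>S \<ge> 10\<close> and a good
  constant in the bound on \<open>q\<^sub>n\<close> for \<open>n \<ge> 6\<close>.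
\<close>

section \<open>The question mark function as a limit of Farey iterates\<close>

text \<open>
  The graph of the question mark function is invariant under the two Farey maps:
  \<open>?(x / (1 + x)) = ?(x) / 2\<close> and \<open>?(1 / (1 + x)) = 1 - ?(x) / 2\<close>. Hence \<open>?\<close> is a
  fixed point of the following operator, which halves distances in the supremum norm on
  \<open>[0, 1]\<close>.
\<close>

definition farey_step :: "(real \<Rightarrow> real) \<Rightarrow> real \<Rightarrow> real" where
  "farey_step f x = (if x \<le> 1 / 2 then f (x / (1 - x)) / 2 else 1 - f ((1 - x) / x) / 2)"

primrec qm_iter :: "nat \<Rightarrow> real \<Rightarrow> real" where
  "qm_iter 0 = (\<lambda>x. x)"
| "qm_iter (Suc n) = farey_step (qm_iter n)"

text \<open>
  The fixed point of \<open>farey_step\<close>, as the limit of its iterates on the identity. It is the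
  question mark function on \<open>[0, 1]\<close>, by \<open>question_mark_eq_qm\<close> below; this description
  gives continuity and monotonicity without any reference to expansions.
\<close>

definition qm :: "real \<Rightarrow> real" where
  "qm x = lim (\<lambda>n. qm_iter n x)"

lemma farey_left_arg:
  fixes x :: real
  assumes "0 \<le> x" "x \<le> 1 / 2"
  shows "x / (1 - x) \<in> {0..1}"
  using assms by (auto simp: divide_simps)

lemma farey_right_arg:
  fixes x :: real
  assumes "1 / 2 \<le> x" "x \<le> 1"
  shows "(1 - x) / x \<in> {0..1}"
  using assms by (auto simp: divide_simps)

text \<open>
  The two branches agree at \<open>1 / 2\<close> because of the normalisation \<open>f 1 = 1\<close>.
\<close>

lemma farey_step_continuous:
  assumes cont: "continuous_on {0..1} f" and f1: "f 1 = 1"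
  shows "continuous_on {0..1} (farey_step f)"
proof -
  have l: "continuous_on {0..1/2} (\<lambda>x::real. f (x / (1 - x)) / 2)"
    by (intro continuous_intros continuous_on_compose2[OF cont])
       (auto simp: divide_simps)
  have r: "continuous_on {1/2..1} (\<lambda>x::real. 1 - f ((1 - x) / x) / 2)"
    by (intro continuous_intros continuous_on_compose2[OF cont])
       (auto simp: divide_simps)
  have "continuous_on ({0..1/2} \<union> {1/2..1})
          (\<lambda>x. if x \<le> 1 / 2 then f (x / (1 - x)) / 2 else 1 - f ((1 - x) / x) / 2)"
  proof (rule continuous_on_cases[OF _ _ l r])
    show "\<forall>x::real. x \<in> {0..1/2} \<and> \<not> x \<le> 1 / 2 \<or> x \<in> {1/2..1} \<and> x \<le> 1 / 2 \<longrightarrow>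
        f (x / (1 - x)) / 2 = 1 - f ((1 - x) / x) / 2"
    proof (intro allI impI)
      fix x :: real
      assume "x \<in> {0..1/2} \<and> \<not> x \<le> 1 / 2 \<or> x \<in> {1/2..1} \<and> x \<le> 1 / 2"
      then have x: "x = 1 / 2" by auto
      show "f (x / (1 - x)) / 2 = 1 - f ((1 - x) / x) / 2" unfolding x by (simp add: f1)
    qed
  qed auto
  moreover have "{0..1/2} \<union> {1/2..1} = {0..1::real}" by auto
  ultimately show ?thesis
    unfolding farey_step_def[abs_def] by simp
qed

lemma qm_iter_endpoints: "qm_iter n 0 = 0" "qm_iter n 1 = 1"
  by (induction n) (auto simp: farey_step_def)

lemma qm_iter_continuous: "continuous_on {0..1} (qm_iter n)"
proof (induction n)
  case 0
  show ?case by simp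
next
  case (Suc n)
  then show ?case by (simp add: farey_step_continuous qm_iter_endpoints)
qed

lemma qm_iter_range:
  "x \<in> {0..1} \<Longrightarrow> qm_iter n x \<in> {0..1} \<and> qm_iter n x \<le> 2 * x"
proof (induction n arbitrary: x)
  case 0
  then show ?case by auto
next
  case (Suc n)
  show ?case
  proof (cases "x \<le> 1 / 2")
    case True
    then have "x / (1 - x) \<in> {0..1}" using Suc.prems farey_left_arg by auto
    from Suc.IH[OF this] have "qm_iter n (x / (1 - x)) \<in> {0..1}"
      "qm_iter n (x / (1 - x)) \<le> 2 * (x / (1 - x))" by auto
    moreover have "x / (1 - x) \<le> 2 * x"
      using True Suc.prems mult_left_mono[of "2 * x" 1 x] by (auto simp: divide_simps algebra_simps)
    ultimately show ?thesis using True by (auto simp: farey_step_def)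
  next
    case False
    then have "(1 - x) / x \<in> {0..1}" using Suc.prems farey_right_arg by auto
    from Suc.IH[OF this] show ?thesis using False by (auto simp: farey_step_def)
  qed
qed

lemma qm_iter_mono:
  "0 \<le> x \<Longrightarrow> x \<le> y \<Longrightarrow> y \<le> 1 \<Longrightarrow> qm_iter n x \<le> qm_iter n y"
proof (induction n arbitrary: x y)
  case 0
  then show ?case by simp
next
  case (Suc n)
  consider "y \<le> 1 / 2" | "x \<le> 1 / 2" "1 / 2 < y" | "1 / 2 < x" by linarith
  then show ?case
  proof cases
    case 1
    then have "x / (1 - x) \<le> y / (1 - y)" using Suc.prems by (intro frac_le) auto
    with 1 Suc show ?thesis
      using farey_left_arg[of x] farey_left_arg[of y] by (auto simp: farey_step_def)
  next
    case 2
    have "qm_iter n (x / (1 - x)) \<le> 1" "qm_iter n ((1 - y) / y) \<le> 1"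
      using qm_iter_range farey_left_arg[of x] farey_right_arg[of y] 2 Suc.prems by fastforce+
    with 2 show ?thesis by (auto simp: farey_step_def)
  next
    case 3
    then have "(1 - y) / y \<le> (1 - x) / x" using Suc.prems by (intro frac_le) auto
    with 3 Suc show ?thesis
      using farey_right_arg[of x] farey_right_arg[of y] by (auto simp: farey_step_def)
  qed
qed

lemma qm_iter_close:
  "x \<in> {0..1} \<Longrightarrow> \<bar>qm_iter (n + k) x - qm_iter n x\<bar> \<le> (1 / 2) ^ n"
proof (induction n arbitrary: x)
  case 0
  then show ?case using qm_iter_range[OF 0, of k] by (auto simp: abs_le_iff)
next
  case (Suc n)
  have half: "\<bar>u / 2 - v / 2\<bar> = \<bar>u - v\<bar> / 2" for u v :: real
    by (simp flip: diff_divide_distrib)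
  show ?case
  proof (cases "x \<le> 1 / 2")
    case True
    then have "x / (1 - x) \<in> {0..1}" using Suc.prems farey_left_arg by auto
    from Suc.IH[OF this] show ?thesis using True by (simp add: farey_step_def half)
  next
    case False
    then have "(1 - x) / x \<in> {0..1}" using Suc.prems farey_right_arg by auto
    from Suc.IH[OF this] show ?thesis
      using False by (simp add: farey_step_def half abs_minus_commute)
  qed
qed

lemma qm_iter_tendsto:
  assumes "x \<in> {0..1}"
  shows "(\<lambda>n. qm_iter n x) \<longlonglongrightarrow> qm x"
proof -
  have "Cauchy (\<lambda>n. qm_iter n x)"
  proof (rule CauchyI')
    fix e :: real
    assume "e > 0"
    then obtain M where M: "(1 / 2 :: real) ^ M < e"
      using real_arch_pow_inv[of e "1/2"] by auto
    have "dist (qm_iter m x) (qm_iter n x) < e" if "M \<le> m" "m < n" for m n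
    proof -
      have "\<bar>qm_iter n x - qm_iter m x\<bar> \<le> (1 / 2) ^ m"
        using qm_iter_close[OF assms, of m "n - m"] that by simp
      also have "\<dots> \<le> (1 / 2) ^ M" using that by (intro power_decreasing) auto
      finally show ?thesis using M by (simp add: dist_real_def abs_minus_commute)
    qed
    then show "\<exists>M. \<forall>m\<ge>M. \<forall>n>m. dist (qm_iter m x) (qm_iter n x) < e" by blast
  qed
  then show ?thesis
    unfolding qm_def by (simp add: Cauchy_convergent_iff convergent_LIMSEQ_iff)
qed

lemma qm_iter_error:
  assumes "x \<in> {0..1}"
  shows "\<bar>qm x - qm_iter n x\<bar> \<le> (1 / 2) ^ n"
proof (rule LIMSEQ_le_const2)
  show "(\<lambda>k. \<bar>qm_iter (k + n) x - qm_iter n x\<bar>) \<longlonglongrightarrow> \<bar>qm x - qm_iter n x\<bar>"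
    using LIMSEQ_ignore_initial_segment[OF qm_iter_tendsto[OF assms], of n]
    by (intro tendsto_intros)
  show "\<exists>N. \<forall>k\<ge>N. \<bar>qm_iter (k + n) x - qm_iter n x\<bar> \<le> (1 / 2) ^ n"
    using qm_iter_close[OF assms, of n] by (auto simp: add.commute)
qed

lemma qm_continuous: "continuous_on {0..1} qm"
proof (rule uniform_limit_theorem)
  show "\<forall>\<^sub>F n in sequentially. continuous_on {0..1} (qm_iter n)"
    by (simp add: qm_iter_continuous)
  show "uniform_limit {0..1} qm_iter qm sequentially"
  proof (rule uniform_limitI)
    fix e :: real
    assume "e > 0"
    then obtain M where M: "(1 / 2 :: real) ^ M < e"
      using real_arch_pow_inv[of e "1/2"] by auto
    have "dist (qm_iter n x) (qm x) < e" if "M \<le> n" "x \<in> {0..1}" for n x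
    proof -
      have "dist (qm_iter n x) (qm x) \<le> (1 / 2) ^ n"
        using qm_iter_error[OF that(2), of n] by (simp add: dist_real_def abs_minus_commute)
      also have "\<dots> \<le> (1 / 2) ^ M" using that by (intro power_decreasing) auto
      finally show ?thesis using M by simp
    qed
    then show "\<forall>\<^sub>F n in sequentially. \<forall>x\<in>{0..1}. dist (qm_iter n x) (qm x) < e"
      using eventually_sequentially by blast
  qed
qed simp

lemma qm_0: "qm 0 = 0"
  by (simp add: qm_def qm_iter_endpoints)

lemma qm_bounds:
  assumes "x \<in> {0..1}"
  shows "0 \<le> qm x" "qm x \<le> 1" "qm x \<le> 2 * x"
  using LIMSEQ_le_const[OF qm_iter_tendsto[OF assms], of 0]
    LIMSEQ_le_const2[OF qm_iter_tendsto[OF assms], of 1]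
    LIMSEQ_le_const2[OF qm_iter_tendsto[OF assms], of "2 * x"] qm_iter_range[OF assms]
  by auto

lemma qm_mono:
  assumes "0 \<le> x" "x \<le> y" "y \<le> 1"
  shows "qm x \<le> qm y"
  using assms qm_iter_mono
  by (intro LIMSEQ_le[OF qm_iter_tendsto qm_iter_tendsto]) auto

lemma qm_farey:
  assumes "x \<in> {0..1}"
  shows "qm x = farey_step qm x"
proof -
  have "(\<lambda>n. qm_iter (Suc n) x) \<longlonglongrightarrow> farey_step qm x"
  proof (cases "x \<le> 1 / 2")
    case True
    then show ?thesis
      using assms farey_left_arg[of x] by (auto simp: farey_step_def intro!: tendsto_intros qm_iter_tendsto)
  next
    case False
    then show ?thesis
      using assms farey_right_arg[of x] by (auto simp: farey_step_def intro!: tendsto_intros qm_iter_tendsto)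
  qed
  moreover have "(\<lambda>n. qm_iter (Suc n) x) \<longlonglongrightarrow> qm x"
    using LIMSEQ_Suc[OF qm_iter_tendsto[OF assms]] .
  ultimately show ?thesis using LIMSEQ_unique by blast
qed

lemma qm_1: "qm 1 = 1"
  by (simp add: qm_def qm_iter_endpoints)

text \<open>
  The two Farey equations combine to the effect of \<open>?\<close> of prepending the partial quotient
  \<open>n + 1\<close>: the second one starts the induction, the first one carries it.
\<close>

lemma qm_inverse_add:
  assumes "t \<in> {0..1}"
  shows "qm (1 / (real (Suc n) + t)) = (1 - qm t / 2) / 2 ^ n"
proof (induction n)
  case 0
  show ?case
  proof (cases "t = 1")
    case True
    then show ?thesis using qm_farey[of "1 / 2"] by (simp add: farey_step_def qm_1)
  next
    case False
    then have t: "0 \<le> t" "t < 1" using assms by auto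
    then have "\<not> 1 / (1 + t) \<le> 1 / 2" "(1 - 1 / (1 + t)) / (1 / (1 + t)) = t"
      by (auto simp: divide_simps)
    then show ?thesis using qm_farey[of "1 / (1 + t)"] t by (simp add: farey_step_def)
  qed
next
  case (Suc n)
  define z where "z = real (Suc n) + t"
  have z: "z \<ge> 1" using assms by (auto simp: z_def)
  then have "1 / (z + 1) \<in> {0..1}" "1 / (z + 1) \<le> 1 / 2"
    "1 / (z + 1) / (1 - 1 / (z + 1)) = 1 / z" by (auto simp: divide_simps)
  then have "qm (1 / (z + 1)) = qm (1 / z) / 2"
    using qm_farey[of "1 / (z + 1)"] by (simp add: farey_step_def)
  also have "qm (1 / z) = (1 - qm t / 2) / 2 ^ n" unfolding z_def by (rule Suc.IH)
  finally show ?case by (simp add: z_def add_ac)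
qed

section \<open>Continued fractions with a remainder\<close>

text \<open>
  \<open>cf a n t\<close> is the continued fraction with partial quotients \<open>a 1, \<dots>, a n\<close> and remainder
  \<open>t\<close> added to the last one, that is \<open>[a 1, \<dots>, a n + t]\<close>; it is \<open>t\<close> itself for \<open>n = 0\<close>.
  The recursion extends the expansion at its end.
\<close>

primrec cf :: "(nat \<Rightarrow> nat) \<Rightarrow> nat \<Rightarrow> real \<Rightarrow> real" where
  "cf a 0 t = t"
| "cf a (Suc n) t = cf a n (1 / (real (a (Suc n)) + t))"

text \<open>
  The denominators \<open>q\<^sub>n\<close> and \<open>q\<^sub>n\<^sub>-\<^sub>1\<close> of the convergents, as real numbers, with
  \<open>q\<^sub>-\<^sub>1 = 0\<close>.
\<close>

fun den :: "(nat \<Rightarrow> nat) \<Rightarrow> nat \<Rightarrow> real"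
  and den_prev :: "(nat \<Rightarrow> nat) \<Rightarrow> nat \<Rightarrow> real" where
  "den a 0 = 1"
| "den a (Suc n) = real (a (Suc n)) * den a n + den_prev a n"
| "den_prev a 0 = 0"
| "den_prev a (Suc n) = den a n"

lemma cf_Suc_shift: "cf a (Suc n) t = 1 / (real (a 1) + cf (\<lambda>i. a (Suc i)) n t)"
  by (induction n arbitrary: t) auto

lemma fin_cfrac_eq_cf: "fin_cfrac a n = cf a n 0"
proof -
  have c: "cfrac as = foldr (\<lambda>c s. 1 / (real c + s)) as 0" for as
    by (induction as) auto
  have "foldr (\<lambda>c s. 1 / (real c + s)) (map a [1..<n + 1]) t = cf a n t" for t
    by (induction n arbitrary: t) auto
  then show ?thesis by (simp add: fin_cfrac_def c)
qed

lemma cf_step_range: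
  assumes "c > 0" "t \<in> {0..1}"
  shows "1 / (real c + t) \<in> {0..1}"
  using assms by (auto simp: divide_simps)

lemma cf_range:
  assumes "\<forall>i\<in>{1..n}. a i > 0" "t \<in> {0..1}"
  shows "cf a n t \<in> {0..1}"
  using assms
proof (induction n arbitrary: t)
  case (Suc n)
  then show ?case using cf_step_range[of "a (Suc n)" t] by simp
qed simp

lemma qm_step:
  assumes "c > 0" "t \<in> {0..1}"
  shows "qm (1 / (real c + t)) = 2 * (1 - qm t / 2) / 2 ^ c"
proof -
  obtain m where "c = Suc m" using assms(1) gr0_implies_Suc by blast
  then show ?thesis using qm_inverse_add[OF assms(2), of m] by (simp add: field_simps del: of_nat_Suc)
qed

text \<open>
  On a cylinder, \<open>?\<close> is an affine function of \<open>?\<close> of the remainder. With \<open>t = 0\<close> this is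
  the finite alternating sum.
\<close>

lemma qm_cf:
  assumes "\<forall>i\<in>{1..n}. a i > 0" "t \<in> {0..1}"
  shows "qm (cf a n t) = (\<Sum>k=1..n. qm_term a k) + (-1) ^ n * qm t / 2 ^ (\<Sum>i=1..n. a i)"
  using assms
proof (induction n arbitrary: t)
  case (Suc n)
  define S where "S = (\<Sum>i=1..n. a i)"
  define c where "c = a (Suc n)"
  have c: "c > 0" using Suc.prems by (simp add: c_def)
  have "qm (cf a (Suc n) t) = (\<Sum>k=1..n. qm_term a k) +
      (-1) ^ n * (2 * (1 - qm t / 2) / 2 ^ c) / 2 ^ S"
    using Suc.IH[of "1 / (real c + t)"] Suc.prems cf_step_range[OF c, of t] qm_step[OF c, of t]
    by (simp add: S_def c_def)
  moreover have S_Suc: "(\<Sum>i=1..Suc n. a i) = S + c" by (simp add: S_def c_def)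
  moreover have "qm_term a (Suc n) = (-1) ^ n * (2 / 2 ^ c / 2 ^ S)"
  proof -
    have "(2::real) ^ (S + c) = 2 * 2 ^ (S + c - 1)"
      using c by (cases "S + c") auto
    then show ?thesis
      unfolding qm_term_def S_Suc by (simp add: power_add field_simps)
  qed
  ultimately show ?case by (simp add: power_add field_simps)
qed simp

lemma den_bounds:
  assumes "\<forall>i\<in>{1..n}. a i > 0"
  shows "1 \<le> den a n" "0 \<le> den_prev a n" "den_prev a n \<le> den a n"
proof -
  have "1 \<le> den a n \<and> 0 \<le> den_prev a n \<and> den_prev a n \<le> den a n"
    using assms
  proof (induction n)
    case (Suc n)
    then have IH: "1 \<le> den a n" "0 \<le> den_prev a n" by auto
    have "1 * den a n \<le> real (a (Suc n)) * den a n"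
      using Suc.prems IH by (intro mult_right_mono) (auto simp: Suc_le_eq)
    with IH show ?case unfolding den.simps den_prev.simps by (intro conjI) linarith+
  qed simp
  then show "1 \<le> den a n" "0 \<le> den_prev a n" "den_prev a n \<le> den a n" by auto
qed

lemma den_ge:
  assumes "\<forall>i\<in>{1..n}. a i > 0"
  shows "real n \<le> den a n"
  using assms
proof (induction n)
  case (Suc n)
  then have pos: "\<forall>i\<in>{1..n}. a i > 0" and IH: "real n \<le> den a n" by auto
  show ?case
  proof (cases n)
    case 0
    then show ?thesis using Suc.prems by simp
  next
    case (Suc m)
    have "1 * den a n \<le> real (a (Suc n)) * den a n"
      using Suc.prems den_bounds(1)[OF pos] by (intro mult_right_mono) (auto simp: Suc_le_eq)
    moreover have "1 \<le> den_prev a n" using den_bounds(1)[of m a] pos Suc by simp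
    ultimately show ?thesis using IH unfolding den.simps by linarith
  qed
qed simp

text \<open>
  The Moebius map \<open>cf a n\<close> has determinant \<open>(-1) ^ n\<close>, so differences of its values do not
  involve the numerators of the convergents.
\<close>

lemma cf_diff:
  assumes "\<forall>i\<in>{1..n}. a i > 0" "0 \<le> s" "0 \<le> u"
  shows "cf a n s - cf a n u =
    (-1) ^ n * (s - u) / ((den a n + den_prev a n * s) * (den a n + den_prev a n * u))"
  using assms
proof (induction n arbitrary: s u)
  case (Suc n)
  define c q q' where "c = real (a (Suc n))" and "q = den a n" and "q' = den_prev a n"
  have pos: "\<forall>i\<in>{1..n}. a i > 0" using Suc.prems by auto
  have c: "c \<ge> 1" using Suc.prems by (auto simp: c_def Suc_le_eq)
  have q: "q \<ge> 1" "q' \<ge> 0" using den_bounds[OF pos] by (auto simp: q_def q'_def)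
  have cs: "c + s > 0" "c + u > 0" using c Suc.prems by auto
  have e: "q + q' * (1 / (c + s)) = (c * q + q' + q * s) / (c + s)"
    "q + q' * (1 / (c + u)) = (c * q + q' + q * u) / (c + u)"
    "1 / (c + s) - 1 / (c + u) = (u - s) / ((c + s) * (c + u))"
    using cs by (auto simp: divide_simps) (auto simp: algebra_simps)
  have "c * q + q' + q * s > 0" "c * q + q' + q * u > 0"
    using c q Suc.prems by (auto intro!: add_pos_nonneg)
  have "cf a (Suc n) s - cf a (Suc n) u = (-1) ^ n * (1 / (c + s) - 1 / (c + u)) /
      ((q + q' * (1 / (c + s))) * (q + q' * (1 / (c + u))))"
    using Suc.IH[OF pos, of "1 / (c + s)" "1 / (c + u)"] cs by (simp add: c_def q_def q'_def)
  also have "\<dots> = (-1) ^ n * (u - s) / ((c * q + q' + q * s) * (c * q + q' + q * u))"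
    unfolding e using cs by simp
  also have "\<dots> = (-1) ^ Suc n * (s - u) / ((c * q + q' + q * s) * (c * q + q' + q * u))"
    by (simp add: minus_divide_left algebra_simps)
  finally show ?case by (simp add: c_def q_def q'_def)
qed simp

lemma has_inf_cfrac_bounds:
  assumes "has_inf_cfrac x a"
  shows "1 / (real (a 1) + 1) \<le> x" "x \<le> 1"
proof -
  have pos: "\<forall>i\<ge>1. a i > 0" and lim: "(\<lambda>m. cf a m 0) \<longlonglongrightarrow> x"
    using assms by (auto simp: has_inf_cfrac_def fin_cfrac_eq_cf)
  have r: "cf (\<lambda>i. a (Suc i)) m 0 \<in> {0..1}" for m using pos by (intro cf_range) auto
  have "1 / (real (a 1) + 1) \<le> cf a (Suc m) 0 \<and> cf a (Suc m) 0 \<le> 1" for m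
    unfolding cf_Suc_shift using r[of m] pos by (auto simp: divide_simps add_pos_nonneg)
  then show "1 / (real (a 1) + 1) \<le> x" "x \<le> 1"
    using LIMSEQ_le_const[OF LIMSEQ_Suc[OF lim]] LIMSEQ_le_const2[OF LIMSEQ_Suc[OF lim]] by blast+
qed

lemma has_inf_cfrac_pos: "has_inf_cfrac x a \<Longrightarrow> 0 < x"
  using has_inf_cfrac_bounds(1)[of x a] by (smt (verit) divide_pos_pos of_nat_0_le_iff)

text \<open>
  Removing the first partial quotient of an infinite expansion leaves an infinite expansion
  of the remainder.
\<close>

lemma has_inf_cfrac_step:
  assumes "has_inf_cfrac x a"
  obtains s where "has_inf_cfrac s (\<lambda>i. a (Suc i))" "x = 1 / (real (a 1) + s)"
proof
  have pos: "\<forall>i\<ge>1. a i > 0" and lim: "(\<lambda>m. cf a m 0) \<longlonglongrightarrow> x"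
    using assms by (auto simp: has_inf_cfrac_def fin_cfrac_eq_cf)
  have x: "x > 0" using has_inf_cfrac_pos[OF assms] .
  then show "x = 1 / (real (a 1) + (1 / x - real (a 1)))" by simp
  have "(\<lambda>m. 1 / cf a (Suc m) 0 - real (a 1)) \<longlonglongrightarrow> 1 / x - real (a 1)"
    using LIMSEQ_Suc[OF lim] x by (intro tendsto_intros) auto
  then have "(\<lambda>m. cf (\<lambda>i. a (Suc i)) m 0) \<longlonglongrightarrow> 1 / x - real (a 1)"
    unfolding cf_Suc_shift by simp
  then show "has_inf_cfrac (1 / x - real (a 1)) (\<lambda>i. a (Suc i))"
    using pos by (auto simp: has_inf_cfrac_def fin_cfrac_eq_cf)
qed

lemma has_inf_cfrac_less_1:
  assumes "has_inf_cfrac x a"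
  shows "x < 1"
proof -
  obtain s where s: "has_inf_cfrac s (\<lambda>i. a (Suc i))" "x = 1 / (real (a 1) + s)"
    using has_inf_cfrac_step[OF assms] .
  have "a 1 > 0" using assms by (simp add: has_inf_cfrac_def)
  then have "real (a 1) + s > 1" using has_inf_cfrac_pos[OF s(1)] by linarith
  then show ?thesis unfolding s(2) by simp
qed

lemma has_inf_cfrac_tail:
  assumes "has_inf_cfrac x a"
  obtains s where "has_inf_cfrac s (\<lambda>i. a (i + n))" "x = cf a n s"
proof -
  have "\<exists>s. has_inf_cfrac s (\<lambda>i. a (i + n)) \<and> x = cf a n s"
  proof (induction n)
    case 0
    then show ?case using assms by auto
  next
    case (Suc n)
    then obtain s where s: "has_inf_cfrac s (\<lambda>i. a (i + n))" "x = cf a n s" by auto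
        obtain s' where "has_inf_cfrac s' (\<lambda>i. a (Suc i + n))" "s = 1 / (real (a (1 + n)) + s')"
      using has_inf_cfrac_step[OF s(1)] .
    then show ?case using s(2) by (intro exI[of _ s']) simp
  qed
  then show ?thesis using that by blast
qed

lemma qm_fin_cfrac:
  assumes "has_fin_cfrac x a m"
  shows "(\<Sum>k=1..m. qm_term a k) = qm x"
  using assms qm_cf[of m a 0] by (simp add: has_fin_cfrac_def fin_cfrac_eq_cf qm_0)

text \<open>
  By continuity, the series of any infinite expansion has the value \<open>qm x\<close>; uniqueness of
  the expansion plays no role.
\<close>

lemma qm_inf_cfrac:
  assumes "has_inf_cfrac x a"
  shows "(\<lambda>k. qm_term a (k + 1)) sums qm x"
proof -
  have pos: "\<forall>i\<ge>1. a i > 0" and lim: "(\<lambda>m. cf a m 0) \<longlonglongrightarrow> x"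
    using assms by (auto simp: has_inf_cfrac_def fin_cfrac_eq_cf)
  have "(\<lambda>m. qm (cf a m 0)) \<longlonglongrightarrow> qm x"
  proof (rule continuous_on_tendsto_compose[OF qm_continuous lim])
    show "x \<in> {0..1}" using has_inf_cfrac_pos[OF assms] has_inf_cfrac_bounds(2)[OF assms] by simp
    show "\<forall>\<^sub>F m in sequentially. cf a m 0 \<in> {0..1}"
      using pos by (intro always_eventually allI cf_range) auto
  qed
  moreover have "qm (cf a m 0) = (\<Sum>k<m. qm_term a (k + 1))" for m
    using qm_cf[of m a 0] pos
    by (simp add: qm_0 sum.atLeast1_atMost_eq)
  ultimately show ?thesis by (simp add: sums_def)
qed

text \<open>
  The expansion is produced by the Gauss map \<open>y \<mapsto> frac (1 / y)\<close>; it is finite when the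
  orbit of \<open>x\<close> reaches \<open>0\<close>. Otherwise the convergents tend to \<open>x\<close> since \<open>q\<^sub>n \<ge> n\<close>.
\<close>

lemma ex_cfrac:
  assumes x: "0 < x" "x \<le> 1"
  shows "(\<exists>a m. has_fin_cfrac x a m) \<or> (\<exists>a. has_inf_cfrac x a)"
proof -
  define r where "r = rec_nat x (\<lambda>_ y. frac (1 / y))"
  define a where "a = (\<lambda>i. nat \<lfloor>1 / r (i - 1)\<rfloor>)"
  have r_Suc: "r (Suc n) = frac (1 / r n)" and r_0: "r 0 = x" for n by (simp_all add: r_def)
  have r_range: "0 \<le> r n" "r n \<le> 1" for n
    using x by (cases n; simp add: r_Suc r_0 frac_ge_0 less_imp_le[OF frac_lt_1])+
  have a_pos: "a (Suc n) > 0" and r_eq: "r n = 1 / (real (a (Suc n)) + r (Suc n))"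
    if "r n > 0" for n
  proof -
    have "1 / r n \<ge> 1" using that r_range by (simp add: divide_simps)
    then have "\<lfloor>1 / r n\<rfloor> \<ge> 1" by linarith
    then show "a (Suc n) > 0" by (simp add: a_def)
    show "r n = 1 / (real (a (Suc n)) + r (Suc n))"
      using \<open>\<lfloor>1 / r n\<rfloor> \<ge> 1\<close> that by (simp add: a_def r_Suc frac_def)
  qed
  have x_eq: "x = cf a n (r n)" if "\<forall>i<n. r i > 0" for n
    using that by (induction n) (auto simp: r_0 simp flip: r_eq)
  show ?thesis
  proof (cases "\<exists>n. r n = 0")
    case True
    define m where "m = (LEAST n. r n = 0)"
    have "r m = 0" unfolding m_def using True by (rule LeastI_ex)
    have pos: "\<forall>i<m. r i > 0"
    proof (intro allI impI)
      fix i
      assume "i < m"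
      then have "r i \<noteq> 0" unfolding m_def by (rule not_less_Least)
      then show "r i > 0" using r_range(1)[of i] by simp
    qed
    have "m \<ge> 1" using \<open>r m = 0\<close> x r_0 by (cases m) auto
    moreover have "\<forall>i\<in>{1..m}. a i > 0"
    proof
      fix i
      assume "i \<in> {1..m}"
      then obtain j where "i = Suc j" "j < m" by (cases i) auto
      then show "a i > 0" using pos a_pos by blast
    qed
    ultimately have "has_fin_cfrac x a m"
      using x_eq[OF pos] \<open>r m = 0\<close> by (simp add: has_fin_cfrac_def fin_cfrac_eq_cf)
    then show ?thesis by blast
  next
    case False
    then have rpos: "r n > 0" for n using r_range(1)[of n] by (auto simp: less_le)
    have pos: "\<forall>i\<ge>1. a i > 0" using a_pos[OF rpos] by (auto simp: Suc_le_eq gr0_conv_Suc)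
    have bound: "\<bar>cf a n 0 - x\<bar> \<le> 1 / real n" if "n > 0" for n
    proof -
      have pn: "\<forall>i\<in>{1..n}. a i > 0" using pos by auto
      define q q' where "q = den a n" and "q' = den_prev a n"
      have q: "q \<ge> 1" "q' \<ge> 0" "q \<ge> real n"
        using den_bounds[OF pn] den_ge[OF pn] by (auto simp: q_def q'_def)
      have "x - cf a n 0 = (-1) ^ n * r n / ((q + q' * r n) * q)"
        using cf_diff[OF pn, of "r n" 0] x_eq[of n] rpos r_range by (simp add: q_def q'_def)
      then have "\<bar>cf a n 0 - x\<bar> = r n / ((q + q' * r n) * q)"
        using q r_range[of n] by (simp add: abs_minus_commute abs_mult power_abs)
      also have "\<dots> \<le> 1 / (1 * real n)"
      proof (rule frac_le)
        show "1 * real n \<le> (q + q' * r n) * q"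
          using q r_range[of n] that by (intro mult_mono add_increasing2) auto
      qed (use r_range that in auto)
      finally show ?thesis by simp
    qed
    have "(\<lambda>n. cf a n 0 - x) \<longlonglongrightarrow> 0"
    proof (rule Lim_null_comparison)
      show "\<forall>\<^sub>F n in sequentially. norm (cf a n 0 - x) \<le> 1 / real n"
        using eventually_gt_at_top[of 0] by eventually_elim (use bound in simp)
      show "(\<lambda>n. 1 / real n) \<longlonglongrightarrow> 0" by (rule lim_1_over_n)
    qed
    then have "has_inf_cfrac x a"
      using pos by (simp add: has_inf_cfrac_def fin_cfrac_eq_cf LIM_zero_iff)
    then show ?thesis by blast
  qed
qed

lemma question_mark_eq_qm:
  assumes "0 \<le> x" "x \<le> 1"
  shows "question_mark x = qm x"
proof (cases "x = 0")
  case True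
  then show ?thesis by (simp add: question_mark_def qm_0)
next
  case False
  then have "0 < x" using assms by simp
  have "(THE y. (\<exists>a m. has_fin_cfrac x a m \<and> y = (\<Sum>k=1..m. qm_term a k)) \<or>
          (\<exists>a. has_inf_cfrac x a \<and> (\<lambda>k. qm_term a (k + 1)) sums y)) = qm x"
  proof (rule the_equality)
    show "(\<exists>a m. has_fin_cfrac x a m \<and> qm x = (\<Sum>k=1..m. qm_term a k)) \<or>
          (\<exists>a. has_inf_cfrac x a \<and> (\<lambda>k. qm_term a (k + 1)) sums qm x)"
      using ex_cfrac[OF \<open>0 < x\<close> assms(2)] qm_fin_cfrac qm_inf_cfrac by metis
  qed (auto simp del: One_nat_def simp: qm_fin_cfrac dest: sums_unique2[OF qm_inf_cfrac])
  then show ?thesis using False by (simp add: question_mark_def)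
qed

lemma qm_fixed_points_iff: "x \<in> qm_fixed_points \<longleftrightarrow> 0 < x \<and> x < 1 / 2 \<and> qm x = x"
  by (auto simp: qm_fixed_points_def question_mark_eq_qm)

section \<open>Location of the fixed points\<close>

text \<open>
  The value of \<open>?\<close> at the finite continued fraction with the given partial quotients.
\<close>

primrec cf_qm :: "nat list \<Rightarrow> real" where
  "cf_qm [] = 0"
| "cf_qm (c # cs) = (2 - cf_qm cs) / 2 ^ c"

lemma qm_cfrac:
  assumes "\<forall>c\<in>set cs. c > 0"
  shows "cfrac cs \<in> {0..1} \<and> qm (cfrac cs) = cf_qm cs"
  using assms
proof (induction cs)
  case (Cons c cs)
  then have IH: "cfrac cs \<in> {0..1}" "qm (cfrac cs) = cf_qm cs" and c: "c > 0" by auto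
  show ?case
    using cf_step_range[OF c IH(1)] qm_step[OF c IH(1)] IH(2) by (simp add: diff_divide_distrib)
qed (simp add: qm_0)

text \<open>
  As \<open>?\<close> is monotone, a bound on a fixed point may be replaced by its image under \<open>?\<close>.
\<close>

lemma fixed_le_qm:
  assumes "qm x = x" "0 \<le> x" "x \<le> v" "v \<le> 1"
  shows "x \<le> qm v"
  using qm_mono[of x v] assms by simp

lemma qm_le_fixed:
  assumes "qm x = x" "0 \<le> v" "v \<le> x" "x \<le> 1"
  shows "qm v \<le> x"
  using qm_mono[of v x] assms by simp

lemma linear_less_power2: "4 \<le> (n::nat) \<Longrightarrow> 2 * n + 3 < 2 ^ n"
  by (induction n rule: nat_induct_at_least) auto

lemma linear_le_power2: "3 \<le> (n::nat) \<Longrightarrow> 2 * (n + 1) \<le> 2 ^ n"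
  by (induction n rule: nat_induct_at_least) auto

lemma qm_values:
  "qm (3 / 8) = 5 / 16" "qm (2 / 5) = 3 / 8" "qm (13 / 32) = 193 / 512" "qm (5 / 12) = 13 / 32"
  "qm (13 / 31) = 53 / 128" "qm (21 / 50) = 107 / 256" "qm (29 / 69) = 215 / 512"
  "qm (7 / 16) = 29 / 64" "qm (3 / 7) = 7 / 16" "qm (11 / 26) = 55 / 128"
  "qm (27 / 64) = 217 / 512" "qm (8 / 19) = 27 / 64" "qm (45 / 107) = 863 / 2048"
  "qm (37 / 88) = 431 / 1024"
  using qm_cfrac[of "[2,1,2]"] qm_cfrac[of "[2,2]"] qm_cfrac[of "[2,2,6]"]
    qm_cfrac[of "[2,2,2]"] qm_cfrac[of "[2,2,1,1,2]"] qm_cfrac[of "[2,2,1,1,1,2]"]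
    qm_cfrac[of "[2,2,1,1,1,3]"] qm_cfrac[of "[2,3,2]"] qm_cfrac[of "[2,3]"]
    qm_cfrac[of "[2,2,1,3]"] qm_cfrac[of "[2,2,1,2,3]"] qm_cfrac[of "[2,2,1,2]"]
    qm_cfrac[of "[2,2,1,1,1,5]"] qm_cfrac[of "[2,2,1,1,1,4]"]
  by simp_all

lemma qm_step_le:
  assumes "c > 0" "t \<in> {0..1}"
  shows "qm (1 / (real c + t)) \<le> 2 / 2 ^ c"
  unfolding qm_step[OF assms] using qm_bounds(1)[OF assms(2)] by (intro divide_right_mono) auto

text \<open>
  A fixed point in \<open>(0, 1 / 2)\<close> is neither close to \<open>0\<close> nor close to \<open>1 / 2\<close>, as \<open>?\<close> is
  flat at both points: the first partial quotient is \<open>2\<close> and the second one is at most \<open>3\<close>.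
\<close>

lemma fixed_point_coarse_bounds:
  assumes fp: "x \<in> qm_fixed_points" and cf: "has_inf_cfrac x a"
  shows "1 / 3 < x" "x \<le> 4 / 9"
proof -
  have x: "0 < x" "x < 1 / 2" "qm x = x" using fp by (auto simp: qm_fixed_points_iff)
  obtain t where t: "has_inf_cfrac t (\<lambda>i. a (Suc i))" "x = 1 / (real (a 1) + t)"
    using has_inf_cfrac_step[OF cf] .
  have t01: "0 < t" "t < 1" using has_inf_cfrac_pos[OF t(1)] has_inf_cfrac_less_1[OF t(1)] .
  have a1: "a 1 > 0" using cf by (simp add: has_inf_cfrac_def)
  have "a 1 \<noteq> 1" using x t01 t(2) by (auto simp: divide_simps)
  moreover have "\<not> 3 \<le> a 1"
  proof
    assume "3 \<le> a 1"
    then have "real (2 * (a 1 + 1)) \<le> real (2 ^ a 1)"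
      using linear_le_power2 by (simp only: of_nat_le_iff)
    then have p: "2 * (real (a 1) + 1) \<le> 2 ^ a 1" by simp
    have "x \<le> 2 / 2 ^ a 1"
      using qm_step_le[OF a1, of t] t01 x(3) unfolding t(2)[symmetric] by auto
    also have "\<dots> \<le> 1 / (real (a 1) + 1)" using p by (simp add: divide_simps)
    also have "\<dots> < x"
      unfolding t(2) using t01
      by (intro divide_strict_left_mono) (auto intro!: mult_pos_pos add_nonneg_pos)
    finally show False by simp
  qed
  ultimately have a1: "a 1 = 2" using a1 by linarith
  have x_eq: "x = 1 / (2 + t)" using t(2) a1 by simp
  show "1 / 3 < x" unfolding x_eq using t01 by (simp add: divide_simps)
  \<comment> \<open>The equation \<open>?(x) = x\<close> amounts to \<open>?(t) = 2 t / (2 + t)\<close>, which fails for small \<open>t\<close>.\<close>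
  have "1 / 4 \<le> t"
  proof (rule ccontr)
    assume "\<not> 1 / 4 \<le> t"
    define c where "c = a 2"
    obtain w where w: "has_inf_cfrac w (\<lambda>i. a (Suc (Suc i)))" "t = 1 / (real c + w)"
      using has_inf_cfrac_step[OF t(1)] by (auto simp: c_def numeral_2_eq_2)
    have w01: "0 < w" "w < 1" using has_inf_cfrac_pos[OF w(1)] has_inf_cfrac_less_1[OF w(1)] .
    have c: "c > 0" using cf by (simp add: has_inf_cfrac_def c_def)
    have "4 < real c + w"
      using w01 \<open>\<not> 1 / 4 \<le> t\<close> unfolding w(2) by (simp add: divide_simps split: if_splits)
    then have "4 \<le> c" using w01 by linarith
    then have "real (2 * c + 3) < real (2 ^ c)"
      using linear_less_power2 by (simp only: of_nat_less_iff)
    then have p: "2 * (real c + w) + 1 < 2 ^ c" using w01 by simp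
    have "qm t \<le> 2 / 2 ^ c"
      using qm_step_le[OF c, of w] w01 unfolding w(2)[symmetric] by auto
    also have "\<dots> < 2 / (2 * (real c + w) + 1)"
      using p w01 by (intro divide_strict_left_mono) (auto intro!: mult_pos_pos add_nonneg_pos)
    also have "\<dots> = 2 * t / (2 + t)" using w01 by (simp add: w(2) divide_simps)
    finally have "qm t < 2 * t / (2 + t)" .
    moreover have "x = 1 / 2 - qm t / 4"
      using qm_step[of 2 t] t01 x x_eq by (simp add: diff_divide_distrib)
    ultimately show False using t01 unfolding x_eq by (simp add: field_simps)
  qed
  then show "x \<le> 4 / 9" unfolding x_eq by (simp add: divide_simps)
qed

text \<open>
  From the coarse bounds, the interval is narrowed by rationals \<open>v\<close> with few partial
  quotients: if \<open>?(v)\<close> is at most the known lower bound, then \<open>v\<close> is a new lower bound, and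
  likewise for upper bounds. The endpoints reached are \<open>29 / 69 = [2, 2, 1, 1, 1, 3]\<close> and
  \<open>37 / 88 = [2, 2, 1, 1, 1, 4]\<close>.
\<close>

lemma fixed_point_interval:
  assumes "x \<in> qm_fixed_points" "has_inf_cfrac x a"
  shows "29 / 69 < x" "x < 37 / 88"
proof -
  have x: "0 < x" "x < 1 / 2" "qm x = x" using assms by (auto simp: qm_fixed_points_iff)
  have lo: "v < x" if "qm v \<le> w" "w < x" "v \<le> 1" for v w
    using fixed_le_qm[of x v] x that by linarith
  have hi: "x < v" if "w \<le> qm v" "x < w" "0 \<le> v" for v w
    using qm_le_fixed[of x v] x that by linarith
  have "1 / 3 < x" using fixed_point_coarse_bounds[OF assms] by simp
  then have "3 / 8 < x" by (rule lo[rotated]) (auto simp: qm_values)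
  then have "2 / 5 < x" by (rule lo[rotated]) (auto simp: qm_values)
  then have "13 / 32 < x" by (rule lo[rotated]) (auto simp: qm_values)
  then have "5 / 12 < x" by (rule lo[rotated]) (auto simp: qm_values)
  then have "13 / 31 < x" by (rule lo[rotated]) (auto simp: qm_values)
  then have "21 / 50 < x" by (rule lo[rotated]) (auto simp: qm_values)
  then show "29 / 69 < x" by (rule lo[rotated]) (auto simp: qm_values)
  have "x < 29 / 64" using fixed_point_coarse_bounds[OF assms] by simp
  then have "x < 7 / 16" by (rule hi[rotated]) (auto simp: qm_values)
  then have "x < 3 / 7" by (rule hi[rotated]) (auto simp: qm_values)
  then have "x < 11 / 26" by (rule hi[rotated]) (auto simp: qm_values)
  then have "x < 27 / 64" by (rule hi[rotated]) (auto simp: qm_values)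
  then have "x < 8 / 19" by (rule hi[rotated]) (auto simp: qm_values)
  then have "x < 45 / 107" by (rule hi[rotated]) (auto simp: qm_values)
  then show "x < 37 / 88" by (rule hi[rotated]) (auto simp: qm_values)
qed

lemma has_inf_cfrac_digit:
  assumes cf: "has_inf_cfrac x a" and lo: "1 / l < x" and hi: "x < 1 / h"
    and "0 < h" "0 < l" "real c \<le> h" "l \<le> real c + 1"
  obtains s where "a 1 = c" "has_inf_cfrac s (\<lambda>i. a (Suc i))" "h - real c < s" "s < l - real c"
proof -
  obtain s where s: "has_inf_cfrac s (\<lambda>i. a (Suc i))" "x = 1 / (real (a 1) + s)"
    using has_inf_cfrac_step[OF cf] .
  have s01: "0 < s" "s < 1" using has_inf_cfrac_pos[OF s(1)] has_inf_cfrac_less_1[OF s(1)] .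
  have x: "0 < x" using has_inf_cfrac_pos[OF cf] .
  have "h < 1 / x" using hi \<open>0 < h\<close> x by (simp add: field_simps)
  then have 1: "h < real (a 1) + s" using s(2) s01 by simp
  have "1 / x < l" using lo x \<open>0 < l\<close> by (simp add: field_simps)
  then have 2: "real (a 1) + s < l" using s(2) s01 by simp
  have "a 1 = c" using 1 2 s01 \<open>real c \<le> h\<close> \<open>l \<le> real c + 1\<close> by linarith
  with that s(1) 1 2 show thesis by auto
qed

lemma fixed_point_digits:
  assumes "x \<in> qm_fixed_points" "has_inf_cfrac x a"
  shows "a 1 = 2" "a 2 = 2" "a 3 = 1" "a 4 = 1" "a 5 = 1" "a 6 = 3"
proof -
  obtain s1 where s1: "a 1 = 2" "has_inf_cfrac s1 (\<lambda>i. a (Suc i))" "14 / 37 < s1" "s1 < 11 / 29"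
    using has_inf_cfrac_digit[OF assms(2), of "69 / 29" "88 / 37" 2] fixed_point_interval[OF assms]
    by auto
  obtain s2 where s2: "a (Suc 1) = 2" "has_inf_cfrac s2 (\<lambda>i. a (Suc (Suc i)))"
    "7 / 11 < s2" "s2 < 9 / 14"
    using has_inf_cfrac_digit[OF s1(2), of "37 / 14" "29 / 11" 2] s1 by auto
  obtain s3 where s3: "a (Suc (Suc 1)) = 1" "has_inf_cfrac s3 (\<lambda>i. a (Suc (Suc (Suc i))))"
    "5 / 9 < s3" "s3 < 4 / 7"
    using has_inf_cfrac_digit[OF s2(2), of "11 / 7" "14 / 9" 1] s2 by auto
  obtain s4 where s4: "a (Suc (Suc (Suc 1))) = 1"
    "has_inf_cfrac s4 (\<lambda>i. a (Suc (Suc (Suc (Suc i)))))" "3 / 4 < s4" "s4 < 4 / 5"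
    using has_inf_cfrac_digit[OF s3(2), of "9 / 5" "7 / 4" 1] s3 by auto
  obtain s5 where s5: "a (Suc (Suc (Suc (Suc 1)))) = 1"
    "has_inf_cfrac s5 (\<lambda>i. a (Suc (Suc (Suc (Suc (Suc i))))))" "1 / 4 < s5" "s5 < 1 / 3"
    using has_inf_cfrac_digit[OF s4(2), of "4 / 3" "5 / 4" 1] s4 by auto
  have s6: "a (Suc (Suc (Suc (Suc (Suc 1))))) = 3"
    using has_inf_cfrac_digit[OF s5(2), of 4 3 3] s5 by auto
  show "a 1 = 2" "a 2 = 2" "a 3 = 1" "a 4 = 1" "a 5 = 1" "a 6 = 3"
    using s1(1) s2(1) s3(1) s4(1) s5(1) s6 by (simp_all add: eval_nat_numeral)
qed

text \<open>
  Between the point \<open>2 / 5\<close>, where \<open>?\<close> is below the diagonal, and the smallest fixed point,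
  \<open>?\<close> cannot cross the diagonal.
\<close>

lemma smallest_fixed_point_qm_less:
  assumes x: "x \<in> qm_fixed_points" "\<forall>y\<in>qm_fixed_points. x \<le> y"
    and y: "2 / 5 \<le> y" "y < x"
  shows "qm y < y"
proof (rule ccontr)
  assume "\<not> qm y < y"
  have x2: "x < 1 / 2" using x by (simp add: qm_fixed_points_iff)
  have "continuous_on {2/5..y} (\<lambda>z. qm z - z)"
    using y x2 by (intro continuous_intros continuous_on_subset[OF qm_continuous]) auto
  then obtain z where "2 / 5 \<le> z" "z \<le> y" "qm z - z = 0"
    using IVT'[of "\<lambda>z. qm z - z" "2 / 5" 0 y] y \<open>\<not> qm y < y\<close> qm_values(2) by auto
  then have "z \<in> qm_fixed_points" using y x2 by (auto simp: qm_fixed_points_iff)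
  then show False using x(2) \<open>z \<le> y\<close> y by force
qed

text \<open>
  Likewise between the greatest fixed point and \<open>3 / 7\<close>, where \<open>?\<close> is above the diagonal.
\<close>

lemma greatest_fixed_point_qm_greater:
  assumes x: "x \<in> qm_fixed_points" "\<forall>y\<in>qm_fixed_points. y \<le> x"
    and y: "x < y" "y \<le> 3 / 7"
  shows "y < qm y"
proof (rule ccontr)
  assume "\<not> y < qm y"
  have x2: "0 < x" using x by (simp add: qm_fixed_points_iff)
  have "continuous_on {y..3/7} (\<lambda>z. qm z - z)"
    using y x2 by (intro continuous_intros continuous_on_subset[OF qm_continuous]) auto
  then obtain z where "y \<le> z" "z \<le> 3 / 7" "qm z - z = 0"
    using IVT'[of "\<lambda>z. qm z - z" y 0 "3 / 7"] y \<open>\<not> y < qm y\<close> qm_values(9) by auto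
  then have "z \<in> qm_fixed_points" using y x2 by (auto simp: qm_fixed_points_iff)
  then show False using x(2) \<open>y \<le> z\<close> y by force
qed

section \<open>The slope at an extremal fixed point\<close>

lemma cf_cylinder:
  assumes "\<forall>i\<ge>1. a i > 0" "a 1 = 2" "a 2 = 2" "n \<ge> 2" "u \<in> {0..1}"
  shows "cf a n u \<in> {2/5..3/7}"
proof -
  obtain k where n: "n = Suc (Suc k)" using assms(4) by (metis Suc_le_D numeral_2_eq_2 Suc_le_mono)
  define w where "w = cf (\<lambda>i. a (Suc (Suc i))) k u"
  have w: "w \<in> {0..1}" unfolding w_def using assms by (intro cf_range) auto
  have "cf a n u = 1 / (2 + 1 / (2 + w))"
    using assms(2,3) unfolding n cf_Suc_shift by (simp add: w_def numeral_2_eq_2)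
  also have "\<dots> = (2 + w) / (5 + 2 * w)" using w by (simp add: divide_simps)
  finally have e: "cf a n u = (2 + w) / (5 + 2 * w)" .
  show ?thesis unfolding e using w by (auto simp: divide_simps)
qed

text \<open>
  The core of the argument. On the side of \<open>x\<close> where \<open>?\<close> is steeper than the diagonal as seen
  from \<open>x\<close>, choose a point \<open>y\<close> which is close to \<open>x\<close> when \<open>A\<close> is large: the convergent
  \<open>cf a n 0\<close> if it lies on that side, and otherwise the point \<open>[a 1, \<dots>, a n, A - 1]\<close>, which lies
  on the opposite side of \<open>x\<close>. The slope of \<open>?\<close> over the interval with endpoints \<open>x\<close> and \<open>y\<close>
  exceeds \<open>1\<close>, but it is at most \<open>2 q\<^sub>n\<^sup>2 A (A + 2) 2 ^ (- A - S)\<close>. In the second case this uses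
  \<open>?(\<theta>) \<le> 2 \<theta>\<close>.
\<close>

lemma partial_quotient_bound:
  assumes fp: "x \<in> qm_fixed_points"
    and extremal: "(\<forall>y\<in>qm_fixed_points. x \<le> y) \<or> (\<forall>y\<in>qm_fixed_points. y \<le> x)"
    and cf: "has_inf_cfrac x a"
    and n: "n \<ge> 2" and A: "A = a (Suc n)" "A \<ge> 2"
  shows "2 ^ (A + (\<Sum>i=1..n. a i)) < 2 * (den a n)\<^sup>2 * (real A * (real A + 2))"
proof -
  define S q q' where "S = (\<Sum>i=1..n. a i)" and "q = den a n" and "q' = den_prev a n"
  have pos: "\<forall>i\<ge>1. a i > 0" using cf by (simp add: has_inf_cfrac_def)
  then have posn: "\<forall>i\<in>{1..n}. a i > 0" by auto
  have q: "q \<ge> 1" "0 \<le> q'" "q' \<le> q" using den_bounds[OF posn] by (auto simp: q_def q'_def)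
  obtain s where s: "has_inf_cfrac s (\<lambda>i. a (i + n))" "x = cf a n s"
    using has_inf_cfrac_tail[OF cf] .
  obtain \<theta> where \<theta>: "has_inf_cfrac \<theta> (\<lambda>i. a (Suc i + n))" "s = 1 / (real (a (1 + n)) + \<theta>)"
    using has_inf_cfrac_step[OF s(1)] .
  have \<theta>01: "0 < \<theta>" "\<theta> < 1" using has_inf_cfrac_pos[OF \<theta>(1)] has_inf_cfrac_less_1[OF \<theta>(1)] .
  have s_eq: "s = 1 / (real A + \<theta>)" using \<theta>(2) A by simp
  have s01: "0 < s" "s < 1" using has_inf_cfrac_pos[OF s(1)] has_inf_cfrac_less_1[OF s(1)] .
  have qms: "qm s = (2 - qm \<theta>) / 2 ^ A"
    unfolding s_eq using qm_step[of A \<theta>] A \<theta>01 by simp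
  have x: "qm x = x" using fp by (simp add: qm_fixed_points_iff)
  \<comment> \<open>\<open>(s - u) / M u\<close> is, up to sign, the difference of \<open>cf a n\<close> at \<open>s\<close> and at \<open>u\<close>.\<close>
  define M where "M u = (q + q' * s) * (q + q' * u)" for u
  have M: "0 < M u" "M u \<le> q\<^sup>2 * ((1 + s) * (1 + u))" if "0 \<le> u" for u
  proof -
    have "q' * s \<le> q * s" "q' * u \<le> q * u" using q s01 that by (intro mult_right_mono; simp)+
    then have "(q + q' * s) * (q + q' * u) \<le> (q + q * s) * (q + q * u)"
      using q s01 that by (intro mult_mono) auto
    then show "M u \<le> q\<^sup>2 * ((1 + s) * (1 + u))"
      by (simp add: M_def power2_eq_square algebra_simps)
    show "0 < M u"
      unfolding M_def using q s01 that by (intro mult_pos_pos add_pos_nonneg) auto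
  qed
  have diff: "x - cf a n u = (-1) ^ n * ((s - u) / M u)"
    and qdiff: "x - qm (cf a n u) = (-1) ^ n * ((qm s - qm u) / 2 ^ S)"
    and cyl: "cf a n u \<in> {2/5..3/7}" if "u \<in> {0..1}" for u
  proof -
    show "x - cf a n u = (-1) ^ n * ((s - u) / M u)"
      unfolding s(2) M_def using cf_diff[OF posn, of s u] s01 that by (simp add: q_def q'_def)
    have "qm x - qm (cf a n u) = (-1) ^ n * qm s / 2 ^ S - (-1) ^ n * qm u / 2 ^ S"
      unfolding s(2) using qm_cf[OF posn, of s] qm_cf[OF posn, of u] s01 that by (simp add: S_def)
    then show "x - qm (cf a n u) = (-1) ^ n * ((qm s - qm u) / 2 ^ S)"
      using x by (simp add: algebra_simps diff_divide_distrib)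
    show "cf a n u \<in> {2/5..3/7}"
      using cf_cylinder[OF pos _ _ n that] fixed_point_digits[OF fp cf] by simp
  qed
  have steep: "\<bar>s - u\<bar> / M u < \<bar>qm s - qm u\<bar> / 2 ^ S"
    if u: "u \<in> {0..1}" and side: "(\<forall>y\<in>qm_fixed_points. x \<le> y) \<and> cf a n u < x \<or>
      (\<forall>y\<in>qm_fixed_points. y \<le> x) \<and> x < cf a n u" for u
  proof -
    have "\<bar>x - cf a n u\<bar> < \<bar>x - qm (cf a n u)\<bar>"
      using side smallest_fixed_point_qm_less[OF fp, of "cf a n u"]
        greatest_fixed_point_qm_greater[OF fp, of "cf a n u"] cyl[OF u] by auto
    then show ?thesis
      unfolding diff[OF u] qdiff[OF u] using M(1)[of u] u by (simp add: abs_mult power_abs)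
  qed
  \<comment> \<open>\<open>cf a n u\<close> is \<open>[a 1, \<dots>, a n, A - 1]\<close>.\<close>
  define u where "u = 1 / (real A - 1)"
  have u: "u \<in> {0..1}" "s < u"
    using A \<theta>01 by (auto simp: u_def s_eq divide_simps)
  have side_0: "0 < (-1) ^ n * (x - cf a n 0)" using diff[of 0] s01 M(1)[of 0] by simp
  have side_u: "0 < (-1) ^ n * (cf a n u - x)"
  proof -
    have "(-1) ^ n * (x - cf a n u) = (s - u) / M u"
      unfolding diff[OF u(1)] by (simp flip: mult.assoc power_mult_distrib)
    also have "\<dots> < 0" using u M(1)[of u] by (simp add: divide_neg_pos)
    finally show ?thesis by (simp add: algebra_simps)
  qed
  \<comment> \<open>The parity of \<open>n\<close> decides on which side of \<open>x\<close> the convergent lies.\<close>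
  consider "s / M 0 < qm s / 2 ^ S" | "(u - s) / M u < (qm u - qm s) / 2 ^ S"
  proof (cases "even n \<longleftrightarrow> (\<forall>y\<in>qm_fixed_points. x \<le> y)")
    case True
    then have "(\<forall>y\<in>qm_fixed_points. x \<le> y) \<and> cf a n 0 < x \<or>
      (\<forall>y\<in>qm_fixed_points. y \<le> x) \<and> x < cf a n 0"
      using extremal side_0 by (cases "even n") auto
    from steep[OF _ this] show thesis using that(1) s01 qm_0 qm_bounds(1)[of s] by auto
  next
    case False
    then have "(\<forall>y\<in>qm_fixed_points. x \<le> y) \<and> cf a n u < x \<or>
      (\<forall>y\<in>qm_fixed_points. y \<le> x) \<and> x < cf a n u"
      using extremal side_u by (cases "even n") auto
    from steep[OF u(1) this] show thesis using that(2) u s01 qm_mono[of s u] by auto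
  qed
  then show ?thesis
  proof cases
    case 1
    have "1 / (q\<^sup>2 * (real A + 2)) \<le> 1 / (q\<^sup>2 * (real A + \<theta> + 1))"
      using A \<theta>01 q by (intro divide_left_mono mult_left_mono mult_pos_pos) auto
    also have "\<dots> = s / (q\<^sup>2 * ((1 + s) * (1 + 0)))"
      using A \<theta>01 q by (simp add: s_eq field_simps)
    also have "\<dots> \<le> s / M 0"
      using M[of 0] s01 q by (intro divide_left_mono mult_pos_pos) auto
    also have "\<dots> < qm s / 2 ^ S" by (rule 1)
    also have "\<dots> \<le> 2 / 2 ^ (A + S)"
      using qms \<theta>01 qm_bounds(1)[of \<theta>] by (simp add: power_add divide_right_mono)
    finally have "1 / (q\<^sup>2 * (real A + 2)) < 2 / 2 ^ (A + S)" .
    moreover have "0 < q\<^sup>2 * (real A + 2)" using q by simp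
    moreover have "P < 2 * Q" if "1 / Q < 2 / P" "0 < Q" "0 < P" for P Q :: real
      using that by (simp add: field_simps)
    ultimately have "2 ^ (A + S) < 2 * (q\<^sup>2 * (real A + 2))" by simp
    also have "\<dots> \<le> 2 * q\<^sup>2 * (real A * (real A + 2))"
      using q A by (simp add: mult_le_cancel_left mult_le_cancel_right)
    finally show ?thesis by (simp add: S_def q_def)
  next
    case 2
    have qmu: "qm u = 4 / 2 ^ A"
    proof -
      have "real A - 1 = real (A - 1) + 0" "(2::real) ^ A = 2 * 2 ^ (A - 1)"
        using A by (auto simp flip: power_Suc)
      then show ?thesis using qm_step[of "A - 1" 0] A by (simp add: u_def qm_0)
    qed
    have "qm u - qm s = (2 + qm \<theta>) / 2 ^ A" unfolding qmu qms by (simp flip: diff_divide_distrib)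
    also have "\<dots> \<le> 2 * (1 + \<theta>) / 2 ^ A"
      using \<theta>01 qm_bounds(3)[of \<theta>] by (intro divide_right_mono) auto
    finally have num: "(qm u - qm s) / 2 ^ S \<le> 2 * (1 + \<theta>) / 2 ^ (A + S)"
      by (simp add: power_add divide_right_mono flip: divide_divide_eq_left)
    have "(1 + \<theta>) / (q\<^sup>2 * (real A * (real A + 2))) \<le> (1 + \<theta>) / (q\<^sup>2 * (real A * (real A + \<theta> + 1)))"
      using A \<theta>01 q by (intro divide_left_mono mult_left_mono mult_pos_pos) auto
    also have "\<dots> = (u - s) / (q\<^sup>2 * ((1 + s) * (1 + u)))"
    proof -
      have "u - s = (1 + \<theta>) / ((real A - 1) * (real A + \<theta>))"
        "(1 + s) * (1 + u) = real A * (real A + \<theta> + 1) / ((real A - 1) * (real A + \<theta>))"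
        using A \<theta>01 by (simp_all add: s_eq u_def divide_simps)
      then show ?thesis using A \<theta>01 by simp
    qed
    also have "\<dots> \<le> (u - s) / M u"
      using M[of u] u s01 q by (intro divide_left_mono mult_pos_pos) auto
    also have "\<dots> < (qm u - qm s) / 2 ^ S" by (rule 2)
    also note num
    finally have "(1 + \<theta>) / (q\<^sup>2 * (real A * (real A + 2))) < 2 * (1 + \<theta>) / 2 ^ (A + S)" .
    moreover have "0 < q\<^sup>2 * (real A * (real A + 2))" using q A by simp
    moreover have "P < 2 * Q" if "X / Q < 2 * X / P" "0 < X" "0 < Q" "0 < P" for P Q X :: real
      using that mult_less_cancel_left_pos[of X P "2 * Q"] by (simp add: field_simps)
    ultimately have "2 ^ (A + S) < 2 * (q\<^sup>2 * (real A * (real A + 2)))"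
      using \<theta>01 by (metis add_pos_pos zero_less_one zero_less_numeral zero_less_power)
    then show ?thesis by (simp add: S_def q_def)
  qed
qed

section \<open>Growth of denominators and the final estimate\<close>

text \<open>
  The golden ratio \<open>\<phi>\<close>.
\<close>

definition golden :: real where
  "golden = (sqrt 5 + 1) / 2"

lemma golden_bounds: "8 / 5 \<le> golden" "golden \<le> 33 / 20"
proof -
  have "11 / 5 \<le> sqrt 5" by (rule real_le_rsqrt) (simp add: power2_eq_square)
  then show "8 / 5 \<le> golden" by (simp add: golden_def)
  have "sqrt 5 \<le> 23 / 10" by (rule real_le_lsqrt) (auto simp: power2_eq_square)
  then show "golden \<le> 33 / 20" by (simp add: golden_def)
qed

lemma golden_square: "golden * golden = golden + 1"
  by (simp add: golden_def field_simps)

lemma golden_power10: "golden ^ 10 = 55 * golden + 34"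
proof -
  have 2: "golden ^ 2 = golden + 1" by (simp add: power2_eq_square golden_square)
  have "golden ^ 4 = (golden ^ 2) * (golden ^ 2)" by (simp flip: power_add)
  then have 4: "golden ^ 4 = 3 * golden + 2"
    using golden_square by (simp add: 2 algebra_simps)
  have "golden ^ 8 = (golden ^ 4) * (golden ^ 4)" by (simp flip: power_add)
  then have 8: "golden ^ 8 = 21 * golden + 13"
    using golden_square by (simp add: 4 algebra_simps)
  have "golden ^ 10 = (golden ^ 8) * (golden ^ 2)" by (simp flip: power_add)
  then show ?thesis using golden_square by (simp add: 8 2 algebra_simps)
qed

text \<open>
  A partial quotient \<open>n\<close> multiplies the bound on the denominators in the next lemma by at most
  \<open>n + \<phi> - 1\<close>, and the sum of the partial quotients allows for \<open>\<phi> ^ n\<close>. Equality holds for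
  \<open>n = 1\<close>.
\<close>

lemma golden_power_ge: "1 \<le> n \<Longrightarrow> real n + golden - 1 \<le> golden ^ n"
proof (induction n rule: nat_induct_at_least)
  case (Suc n)
  have "1 \<le> golden" using golden_bounds by simp
  have "real (Suc n) + golden - 1 \<le> (real n + golden - 1) * golden"
  proof -
    have "0 \<le> (real n - 1) * (golden - 1)" using Suc golden_bounds by simp
    then show ?thesis using golden_square by (simp add: algebra_simps)
  qed
  also have "\<dots> \<le> golden ^ n * golden" using Suc \<open>1 \<le> golden\<close> by (intro mult_right_mono) auto
  finally show ?case by (simp add: mult.commute)
qed simp

text \<open>
  For every expansion, \<open>q\<^sub>n \<le> \<phi> ^ S\<close>. The constant \<open>3 / 5\<close> is gained from the known first partial
  quotients, for which \<open>q\<^sub>6 = 69\<close>, \<open>S = 10\<close> and \<open>\<phi> ^ 10 > 122\<close>. It is needed in the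
  final estimate, where it enters squared.
\<close>

lemma den_golden_bound:
  assumes pos: "\<forall>i\<ge>1. a i > 0"
    and digits: "a 1 = 2" "a 2 = 2" "a 3 = 1" "a 4 = 1" "a 5 = 1" "a 6 = 3"
    and n: "6 \<le> n"
  shows "den a n \<le> 3 / 5 * golden ^ (\<Sum>i=1..n. a i) \<and>
         den_prev a n * golden \<le> 3 / 5 * golden ^ (\<Sum>i=1..n. a i)"
  using n
proof (induction n rule: nat_induct_at_least)
  case base
  have "den a 6 = 69" "den_prev a 6 = 19" "(\<Sum>i=1..6. a i) = 10"
    using digits by (simp_all add: eval_nat_numeral)
  then show ?case using golden_bounds by (simp add: golden_power10)
next
  case (Suc n)
  define P where "P = golden ^ (\<Sum>i=1..n. a i)"
  define c where "c = a (Suc n)"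
  have c: "c \<ge> 1" using pos by (simp add: c_def Suc_le_eq)
  have g: "1 \<le> golden" using golden_bounds by simp
  have P: "P > 0" using g by (simp add: P_def)
  have IH: "den a n \<le> 3 / 5 * P" "den_prev a n * golden \<le> 3 / 5 * P"
    using Suc.IH by (auto simp: P_def)
  have "golden * (golden - 1) = 1" using golden_square by (simp add: algebra_simps)
  then have "den_prev a n = den_prev a n * golden * (golden - 1)" by (simp add: mult.assoc)
  also have "\<dots> \<le> 3 / 5 * P * (golden - 1)" using IH(2) g by (intro mult_right_mono) auto
  finally have "den_prev a n \<le> 3 / 5 * P * (golden - 1)" .
  moreover have "real c * den a n \<le> real c * (3 / 5 * P)" using IH(1) by (intro mult_left_mono) auto
  ultimately have "real c * den a n + den_prev a n \<le> 3 / 5 * P * (real c + golden - 1)"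
    by (simp add: algebra_simps)
  also have "\<dots> \<le> 3 / 5 * P * golden ^ c"
    using golden_power_ge[OF c] P by (intro mult_left_mono) auto
  finally have 1: "den a (Suc n) \<le> 3 / 5 * (P * golden ^ c)" by (simp add: c_def)
  have "den a n * golden \<le> 3 / 5 * P * golden" using IH(1) g by (intro mult_right_mono) auto
  also have "\<dots> \<le> 3 / 5 * P * golden ^ c"
    using P g c power_increasing[of 1 c golden] by (intro mult_left_mono) auto
  finally have 2: "den_prev a (Suc n) * golden \<le> 3 / 5 * (P * golden ^ c)" by simp
  have "golden ^ (\<Sum>i=1..Suc n. a i) = P * golden ^ c" by (simp add: P_def c_def power_add)
  with 1 2 show ?case by simp
qed

text \<open>
  The defining property of \<open>\<kappa>\<^sub>1\<close> in use: \<open>2 ^ \<kappa>\<^sub>1 = \<phi>\<^sup>2 / 2\<close>.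
\<close>

lemma kappa1_golden: "2 powr (kappa1 * real S) * 2 ^ S = golden ^ S * golden ^ S"
proof -
  have g: "golden > 0" using golden_bounds by linarith
  have "2 powr (kappa1 * real S) * 2 ^ S = 2 powr (kappa1 * real S) * 2 powr real S"
    by (simp add: powr_realpow)
  also have "\<dots> = 2 powr (log 2 golden * real S + log 2 golden * real S)"
    unfolding powr_add[symmetric] by (simp add: kappa1_def golden_def algebra_simps)
  also have "\<dots> = (2 powr log 2 golden) powr real S * (2 powr log 2 golden) powr real S"
    by (simp only: powr_add powr_powr)
  also have "\<dots> = golden ^ S * golden ^ S" using g by (simp add: powr_realpow)
  finally show ?thesis .
qed

lemma kappa1_bounds: "0 < kappa1" "kappa1 \<le> 2 / 5"
proof -
  have g: "golden > 0" using golden_bounds by linarith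
  have "10 * log 2 golden = log 2 (golden ^ 10)" using g by (simp add: log_nat_power)
  also have "\<dots> \<le> log 2 (2 ^ 7)"
    using golden_power10 golden_bounds g by (subst log_le_cancel_iff) auto
  also have "\<dots> = 7" by (subst log_nat_power) auto
  finally show "kappa1 \<le> 2 / 5" by (simp add: kappa1_def golden_def)
  have "(1::real) = log 2 2" by simp
  also have "\<dots> < log 2 (golden ^ 2)"
    using golden_square golden_bounds g by (subst log_less_cancel_iff) (auto simp: power2_eq_square)
  also have "\<dots> = 2 * log 2 golden" using g by (simp add: log_nat_power)
  finally show "0 < kappa1" by (simp add: kappa1_def golden_def)
qed

lemma ln_2_ge_half: "1 / 2 \<le> ln (2::real)"
  using ln_le_minus_one[of "1 / 2 :: real"] by (simp add: ln_div)

text \<open>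
  A weakened form of the tangent bound at \<open>10\<close>, together with \<open>10 ^ 3 \<le> 2 ^ 10\<close>.
\<close>

lemma log_le_linear:
  fixes y :: real
  assumes "10 \<le> y"
  shows "log 2 y \<le> 10 / 3 + (y - 10) / 5"
proof -
  have "3 * log 2 10 = log 2 (10 ^ 3)" by (subst log_nat_power) auto
  also have "\<dots> \<le> log 2 (2 ^ 10)" by (subst log_le_cancel_iff) auto
  also have "\<dots> = 10" by (subst log_nat_power) auto
  finally have 1: "log 2 10 \<le> 10 / 3" by simp
  have "log 2 (y / 10) \<le> (y / 10 - 1) / ln 2"
    unfolding log_def using assms by (intro divide_right_mono ln_le_minus_one) auto
  also have "\<dots> \<le> (y / 10 - 1) / (1 / 2)"
    using assms ln_2_ge_half by (intro divide_left_mono) auto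
  finally have "log 2 (y / 10) \<le> (y - 10) / 5" by simp
  moreover have "log 2 y = log 2 10 + log 2 (y / 10)" using assms by (simp add: log_divide)
  ultimately show ?thesis using 1 by linarith
qed

text \<open>
  Write \<open>A = B + \<delta>\<close>, where \<open>B\<close> is the claimed bound. If \<open>\<delta> \<ge> 0\<close>, then the left hand side of
  the hypothesis is \<open>2 ^ \<delta> S\<^sup>2 \<phi> ^ (2 S)\<close>, while \<open>A + 1 \<le> (7 / 6) S 2 ^ (\<delta> / 2)\<close> bounds the
  right hand side by \<open>2 (3 / 5)\<^sup>2 (7 / 6)\<^sup>2 = 49 / 50\<close> times the same quantity.
\<close>

lemma kappa1_bound_from_power_bound:
  assumes S: "10 \<le> S"
    and q: "0 \<le> q" "q \<le> 3 / 5 * golden ^ S"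
    and main: "2 ^ (A + S) < 2 * q\<^sup>2 * (real A * (real A + 2))"
  shows "real A < kappa1 * real S + 2 * log 2 (real S)"
proof (rule ccontr)
  define B \<delta> where "B = kappa1 * real S + 2 * log 2 (real S)" and "\<delta> = real A - B"
  assume "\<not> ?thesis"
  then have \<delta>: "0 \<le> \<delta>" by (simp add: \<delta>_def B_def)
  have S10: "10 \<le> real S" using S by simp
  have "kappa1 * real S \<le> 2 / 5 * real S" using kappa1_bounds by (intro mult_right_mono) auto
  then have B: "B + 1 \<le> 7 / 6 * real S"
    using log_le_linear[OF S10] S10 unfolding B_def by argo
  have pow: "2 ^ (A + S) = 2 powr \<delta> * (real S)\<^sup>2 * (golden ^ S)\<^sup>2"
  proof -
    have "2 powr (2 * log 2 (real S)) = 2 powr (log 2 (real S) + log 2 (real S))" by simp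
    also have "\<dots> = (real S)\<^sup>2" unfolding powr_add using S10 by (simp add: power2_eq_square)
    finally have S2: "2 powr (2 * log 2 (real S)) = (real S)\<^sup>2" .
    have "2 ^ A = 2 powr (\<delta> + kappa1 * real S + 2 * log 2 (real S))"
      by (simp add: \<delta>_def B_def powr_realpow)
    also have "\<dots> = 2 powr \<delta> * 2 powr (kappa1 * real S) * (real S)\<^sup>2"
      unfolding powr_add S2 ..
    finally have "2 ^ (A + S) = 2 powr \<delta> * (real S)\<^sup>2 * (2 powr (kappa1 * real S) * 2 ^ S)"
      by (simp add: power_add)
    then show ?thesis unfolding kappa1_golden by (simp add: power2_eq_square)
  qed
  have growth: "1 + \<delta> / 4 \<le> 2 powr (\<delta> / 2)"
  proof -
    have "1 + \<delta> / 4 \<le> 1 + \<delta> / 2 * ln 2"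
      using mult_left_mono[OF ln_2_ge_half, of "\<delta> / 2"] \<delta> by simp
    also have "\<dots> \<le> exp (\<delta> / 2 * ln 2)" by (rule exp_ge_add_one_self)
    finally show ?thesis by (simp add: powr_def)
  qed
  have "real A + 1 = (B + 1) + \<delta>" by (simp add: \<delta>_def)
  also have "\<dots> \<le> 7 / 6 * real S + 7 / 6 * real S * (\<delta> / 4)"
    using B \<delta> S10 mult_right_mono[of 4 "7 / 6 * real S" "\<delta> / 4"] by simp
  also have "\<dots> = 7 / 6 * real S * (1 + \<delta> / 4)" by (simp add: algebra_simps)
  also have "\<dots> \<le> 7 / 6 * real S * 2 powr (\<delta> / 2)" using growth by (intro mult_left_mono) auto
  finally have "(real A + 1)\<^sup>2 \<le> (7 / 6 * real S * 2 powr (\<delta> / 2))\<^sup>2"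
    by (intro power_mono) auto
  also have "\<dots> = 49 / 36 * ((real S)\<^sup>2 * 2 powr \<delta>)"
    by (simp add: power_mult_distrib power2_eq_square flip: powr_add)
  finally have A2: "(real A + 1)\<^sup>2 \<le> 49 / 36 * ((real S)\<^sup>2 * 2 powr \<delta>)" .
  have "2 ^ (A + S) < 2 * q\<^sup>2 * (real A * (real A + 2))" by (rule main)
  also have "\<dots> \<le> 2 * (3 / 5 * golden ^ S)\<^sup>2 * (real A + 1)\<^sup>2"
    using q by (intro mult_mono power_mono) (auto simp: power2_eq_square algebra_simps)
  also have "\<dots> \<le> 2 * (3 / 5 * golden ^ S)\<^sup>2 * (49 / 36 * ((real S)\<^sup>2 * 2 powr \<delta>))"
    using A2 by (intro mult_left_mono) auto
  also have "\<dots> = 49 / 50 * (2 powr \<delta> * (real S)\<^sup>2 * (golden ^ S)\<^sup>2)"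
    by (simp add: power2_eq_square)
  also have "\<dots> \<le> 2 powr \<delta> * (real S)\<^sup>2 * (golden ^ S)\<^sup>2" by simp
  finally show False unfolding pow by simp
qed

theorem theorem2:
  fixes x :: real and a :: "nat \<Rightarrow> nat"
  assumes "x \<in> qm_fixed_points"
    and "(\<forall>y\<in>qm_fixed_points. x \<le> y) \<or> (\<forall>y\<in>qm_fixed_points. y \<le> x)"
    and "has_inf_cfrac x a"
  shows "\<forall>n\<ge>1. real (a (n + 1)) <
           kappa1 * real (\<Sum>i=1..n. a i) + 2 * log 2 (real (\<Sum>i=1..n. a i))"
proof (intro allI impI)
  fix n :: nat
  assume n: "1 \<le> n"
  define S where "S = (\<Sum>i=1..n. a i)"
  note digits = fixed_point_digits[OF assms(1,3)]
  have pos: "\<forall>i\<ge>1. a i > 0" using assms(3) by (simp add: has_inf_cfrac_def)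
  \<comment> \<open>The logarithmic term alone suffices for small partial quotients.\<close>
  have trivial: "real c < kappa1 * real S + 2 * log 2 (real S)" if "2 ^ c \<le> S ^ 2" "2 \<le> S" for c
  proof -
    have "real c = log 2 (2 ^ c)" by (subst log_nat_power) auto
    also have "\<dots> \<le> log 2 (real S ^ 2)"
    proof (subst log_le_cancel_iff)
      have "real (2 ^ c) \<le> real (S ^ 2)" using that(1) by (simp only: of_nat_le_iff)
      then show "2 ^ c \<le> real S ^ 2" by simp
    qed (use that in auto)
    also have "\<dots> = 2 * log 2 (real S)" using that by (subst log_nat_power) auto
    finally have "real c \<le> 2 * log 2 (real S)" .
    moreover have "0 < kappa1 * real S" using kappa1_bounds(1) that(2) by simp
    ultimately show ?thesis by linarith
  qed
  consider "n = 1" | "n = 2" | "n = 3" | "n = 4" | "n = 5" | "6 \<le> n" using n by linarith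
  then have "real (a (n + 1)) < kappa1 * real S + 2 * log 2 (real S)"
  proof cases
    assume "6 \<le> n"
    have "(\<Sum>i=1..6. a i) \<le> S" unfolding S_def using \<open>6 \<le> n\<close> by (intro sum_mono2) auto
    moreover have "(\<Sum>i=1..6. a i) = 10" using digits by (simp add: eval_nat_numeral)
    ultimately have S: "10 \<le> S" by simp
    show ?thesis
    proof (cases "a (Suc n) \<le> 1")
      case True
      have "2 ^ a (Suc n) \<le> (2::nat) ^ 1" using True by (intro power_increasing) auto
      also have "\<dots> \<le> S ^ 2" using S power_mono[of 10 S 2] by simp
      finally show ?thesis using trivial[of "a (Suc n)"] S by simp
    next
      case False
      have "2 ^ (a (Suc n) + S) < 2 * (den a n)\<^sup>2 * (real (a (Suc n)) * (real (a (Suc n)) + 2))"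
        unfolding S_def using False \<open>6 \<le> n\<close> by (intro partial_quotient_bound[OF assms]) auto
      moreover have "den a n \<le> 3 / 5 * golden ^ S"
        unfolding S_def using den_golden_bound[OF pos digits \<open>6 \<le> n\<close>] by simp
      moreover have "0 \<le> den a n" using den_bounds(1)[of n a] pos by simp
      ultimately show ?thesis using kappa1_bound_from_power_bound[OF S] by simp
    qed
  qed (use trivial[of "a (n + 1)"] digits in \<open>auto simp: S_def eval_nat_numeral\<close>)
  then show "real (a (n + 1)) <
      kappa1 * real (\<Sum>i=1..n. a i) + 2 * log 2 (real (\<Sum>i=1..n. a i))"
    by (simp add: S_def)
qed

end
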